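(* Let $S$ be an Arf numerical semigroup with multiplicity smaller than four, and let $\Bbbk$ be an algebraically closed field of characteristic zero. Then the defining ideal $I_S$ of $\Bbbk[S]$ is generic.
   Context: A numerical semigroup is a subset $S\subseteq\mathbb{N}_0$ (non-negative integers) containing $0$, closed under addition, with finite complement in $\mathbb{N}_0$. Its multiplicity is its smallest nonzero element. $S$ is Arf if $s_2+s_3-s_1\in S$ for all $s_1\le s_2\le s_3$ in $S$. Let $n_1<\dots<n_e$ be the minimal generators of $S$. $\Bbbk[S]=\Bbbk[t^s\mid s\in S]\subseteq\Bbbk[t]$, and the defining ideal $I_S$ is the kernel of the surjective $\Bbbk$-algebra map $\Bbbk[x_1,\dots,x_e]\to\Bbbk[S]$, $x_i\mapsto t^{n_i}$. For $\mathbf{a}\in\mathbb{N}_0^e$, $\mathbf{x}^{\mathbf{a}}=x_1^{a_1}\cdots x_e^{a_e}$ and $\mathrm{Supp}\,\mathbf{a}=\{i\mid a_i\ne0\}$. A binomial $\phi=\mathbf{x}^{\mathbf{a}}-\mathbf{x}^{\mathbf{b}}$ has full support if $\mathrm{Supp}\,\mathbf{a}\cup\mathrm{Supp}\,\mathbf{b}=\{1,\dots,e\}$. $I_S$ is called generic if it has a minimal generating system consisting of binomials with full support (for $S=\mathbb{N}_0$, $I_S=0$ has the empty minimal generating system). *)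

theory Defs
  imports
    Complex_Main
    "HOL-Library.Poly_Mapping"
    "HOL-Computational_Algebra.Polynomial"
    "HOL-Algebra.Generated_Rings"
begin

section \<open>Numerical semigroups\<close>

definition add_submonoid :: "nat set \<Rightarrow> bool" where
  "add_submonoid T \<longleftrightarrow> 0 \<in> T \<and> (\<forall>a\<in>T. \<forall>b\<in>T. a + b \<in> T)"

definition numerical_semigroup :: "nat set \<Rightarrow> bool" where
  "numerical_semigroup S \<longleftrightarrow> add_submonoid S \<and> finite (- S)"

definition multiplicity_of :: "nat set \<Rightarrow> nat" where
  "multiplicity_of S = (LEAST n. n \<in> S \<and> n \<noteq> 0)"

definition arf :: "nat set \<Rightarrow> bool" where
  "arf S \<longleftrightarrow> (\<forall>s1\<in>S. \<forall>s2\<in>S. \<forall>s3\<in>S. s1 \<le> s2 \<longrightarrow> s2 \<le> s3 \<longrightarrow> s2 + s3 - s1 \<in> S)"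

definition minimal_generating_set :: "nat set \<Rightarrow> nat set \<Rightarrow> bool" where
  "minimal_generating_set S A \<longleftrightarrow>
     add_submonoid hull A = S \<and> (\<forall>B. B \<subset> A \<longrightarrow> add_submonoid hull B \<noteq> S)"

text \<open>Every submonoid has exactly one minimal generating set, see
  \<open>ex1_minimal_generating_set\<close> below.\<close>

definition minimal_generators :: "nat set \<Rightarrow> nat set" where
  "minimal_generators S = (THE A. minimal_generating_set S A)"

definition embdim :: "nat set \<Rightarrow> nat" where
  "embdim S = card (minimal_generators S)"

text \<open>For \<open>1 \<le> i \<le> embdim S\<close>, \<open>gen S i\<close> is the \<open>i\<close>-th minimal generator in increasing order.\<close>

definition gen :: "nat set \<Rightarrow> nat \<Rightarrow> nat" where
  "gen S i = sorted_list_of_set (minimal_generators S) ! (i - 1)"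

lemma add_submonoid_hull: "add_submonoid (add_submonoid hull A)"
  by (rule hull_in) (auto simp: add_submonoid_def)

lemma minimal_generating_set_iff:
  assumes S: "add_submonoid S"
  shows "minimal_generating_set S A \<longleftrightarrow>
           A = {n \<in> S. n \<noteq> 0 \<and> \<not> (\<exists>a\<in>S - {0}. \<exists>b\<in>S - {0}. n = a + b)}"
proof -
  define G where "G = {n \<in> S. n \<noteq> 0 \<and> \<not> (\<exists>a\<in>S - {0}. \<exists>b\<in>S - {0}. n = a + b)}"
  have hull_zero: "0 \<in> add_submonoid hull G"
    and hull_add: "\<And>a b. a \<in> add_submonoid hull G \<Longrightarrow> b \<in> add_submonoid hull G \<Longrightarrow>
                     a + b \<in> add_submonoid hull G"
    using add_submonoid_hull[of G] unfolding add_submonoid_def by blast+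
  have "n \<in> add_submonoid hull G" if "n \<in> S" for n
    using that
  proof (induction n rule: less_induct)
    case (less n)
    show ?case
    proof (cases "n = 0 \<or> n \<in> G")
      case True
      thus ?thesis using hull_zero hull_subset[of G add_submonoid] by blast
    next
      case False
      then obtain a b where "a \<in> S - {0}" "b \<in> S - {0}" "n = a + b"
        using less.prems unfolding G_def by blast
      moreover from this have "a < n" "b < n" by auto
      ultimately show ?thesis
        using less.IH[of a] less.IH[of b] hull_add by blast
    qed
  qed
  moreover have "add_submonoid hull G \<subseteq> S"
    by (rule hull_minimal) (auto simp: G_def S)
  ultimately have hG: "add_submonoid hull G = S" by blast
  have sub: "G \<subseteq> B" if B: "add_submonoid hull B = S" for B
  proof (rule ccontr)
    assume "\<not> G \<subseteq> B"
    then obtain g where g: "g \<in> G" "g \<notin> B" by blast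
    have "add_submonoid (S - {g})"
      unfolding add_submonoid_def
    proof (intro conjI ballI)
      show "0 \<in> S - {g}" using S g by (auto simp: add_submonoid_def G_def)
      fix a b assume ab: "a \<in> S - {g}" "b \<in> S - {g}"
      show "a + b \<in> S - {g}"
      proof (cases "a = 0 \<or> b = 0")
        case True thus ?thesis using ab by auto
      next
        case False
        hence "a + b \<noteq> g" using ab g(1) unfolding G_def by blast
        thus ?thesis using ab S unfolding add_submonoid_def by blast
      qed
    qed
    moreover have "B \<subseteq> S - {g}" using hull_subset[of B add_submonoid] B g by auto
    ultimately have "S \<subseteq> S - {g}" using hull_minimal[of B "S - {g}" add_submonoid] B by simp
    thus False using g by (auto simp: G_def)
  qed
  show ?thesis
    unfolding minimal_generating_set_def G_def[symmetric] using hG sub by blast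
qed

lemma ex1_minimal_generating_set:
  "add_submonoid S \<Longrightarrow> \<exists>!A. minimal_generating_set S A"
  by (simp add: minimal_generating_set_iff)

lemma minimal_generators_eq:
  "add_submonoid S \<Longrightarrow>
     minimal_generators S = {n \<in> S. n \<noteq> 0 \<and> \<not> (\<exists>a\<in>S - {0}. \<exists>b\<in>S - {0}. n = a + b)}"
  by (simp add: minimal_generators_def minimal_generating_set_iff)

lemma finite_minimal_generators:
  assumes S: "add_submonoid S"
  shows "finite (minimal_generators S)"
proof (cases "S \<subseteq> {0}")
  case True
  hence "minimal_generators S \<subseteq> {0}" unfolding minimal_generators_eq[OF S] by blast
  thus ?thesis by (rule finite_subset) simp
next
  case False
  then obtain m where m: "m \<in> S" "m \<noteq> 0" by blast
  have mult: "k * m \<in> S" for k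
    using S m by (induction k) (auto simp: add_submonoid_def)
  have "g = h" if "g \<in> minimal_generators S" "h \<in> minimal_generators S"
      "g \<le> h" "g mod m = h mod m" for g h
  proof (rule ccontr)
    assume "g \<noteq> h"
    from that(3,4) have "m dvd h - g" by (metis mod_eq_dvd_iff_nat)
    then obtain k where "h - g = m * k" by (auto elim: dvdE)
    hence "h = g + k * m" "k * m \<noteq> 0"
      using that(3) \<open>g \<noteq> h\<close>
      by (metis le_add_diff_inverse mult.commute, metis diff_is_0_eq le_antisym mult.commute)
    moreover from this have "k * m \<in> S - {0}" "g \<in> S - {0}"
      using that(1) mult[of k] unfolding minimal_generators_eq[OF S] by blast+
    ultimately show False using that(2) unfolding minimal_generators_eq[OF S] by blast
  qed
  hence "inj_on (\<lambda>g. g mod m) (minimal_generators S)"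
    by (metis inj_onI nat_le_linear)
  moreover have "(\<lambda>g. g mod m) ` minimal_generators S \<subseteq> {..<m}" using m by auto
  ultimately show ?thesis by (meson finite_imageD finite_lessThan finite_subset)
qed


section \<open>The defining ideal\<close>

text \<open>\<open>(nat \<Rightarrow>\<^sub>0 nat) \<Rightarrow>\<^sub>0 'k\<close> is the polynomial ring over \<open>'k\<close> in variables indexed by
  \<^typ>\<open>nat\<close>; \<open>\<^bold>x\<^sup>a\<close> is \<open>Poly_Mapping.single a 1\<close> and \<open>Supp a\<close> is \<open>Poly_Mapping.keys a\<close>.\<close>

type_synonym 'k mpoly = "(nat \<Rightarrow>\<^sub>0 nat) \<Rightarrow>\<^sub>0 'k"

definition subring_on :: "'a::comm_ring_1 set \<Rightarrow> 'a ring" where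
  "subring_on A = \<lparr>carrier = A, mult = (*), one = 1, zero = 0, add = (+)\<rparr>"

text \<open>\<open>\<bbbk>[x\<^sub>1, \<dots>, x\<^sub>e]\<close>\<close>

definition polys_in :: "nat \<Rightarrow> 'k::field mpoly set" where
  "polys_in e = {p. \<forall>m\<in>Poly_Mapping.keys p. Poly_Mapping.keys m \<subseteq> {1..e}}"

abbreviation poly_ring :: "nat \<Rightarrow> 'k::field mpoly ring" where
  "poly_ring e \<equiv> subring_on (polys_in e)"

text \<open>\<open>\<bbbk>[S]\<close>, the subring of \<open>\<bbbk>[t]\<close> generated by the constants and the \<open>t\<^sup>s\<close> with \<open>s \<in> S\<close>\<close>

definition semigroup_ring :: "nat set \<Rightarrow> 'k::field poly ring" where
  "semigroup_ring S =
     subring_on (generate_ring (subring_on UNIV)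
       (range (\<lambda>c. [:c:]) \<union> (\<lambda>s. Polynomial.monom 1 s) ` S))"

text \<open>Evaluation of a polynomial at \<open>x\<^sub>i = t ^ gen S i\<close>\<close>

definition param_map :: "nat set \<Rightarrow> 'k::field mpoly \<Rightarrow> 'k poly" where
  "param_map S p =
     (\<Sum>m\<in>Poly_Mapping.keys p. Polynomial.smult (Poly_Mapping.lookup p m)
        (\<Prod>i\<in>{1..embdim S}. Polynomial.monom 1 (gen S i) ^ Poly_Mapping.lookup m i))"

definition defining_ideal :: "nat set \<Rightarrow> 'k::field mpoly set" where
  "defining_ideal S = a_kernel (poly_ring (embdim S)) (semigroup_ring S) (param_map S)"


section \<open>Genericity\<close>

definition minimal_ideal_generators :: "nat \<Rightarrow> 'k::field mpoly set \<Rightarrow> 'k mpoly set \<Rightarrow> bool" where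
  "minimal_ideal_generators e I B \<longleftrightarrow>
     B \<subseteq> polys_in e \<and> Idl\<^bsub>poly_ring e\<^esub> B = I \<and> (\<forall>C. C \<subset> B \<longrightarrow> Idl\<^bsub>poly_ring e\<^esub> C \<noteq> I)"

definition full_support_binomial :: "nat \<Rightarrow> 'k::field mpoly \<Rightarrow> bool" where
  "full_support_binomial e f \<longleftrightarrow>
     (\<exists>a b. f = Poly_Mapping.single a 1 - Poly_Mapping.single b 1 \<and>
            Poly_Mapping.keys a \<union> Poly_Mapping.keys b = {1..e})"

definition generic :: "nat \<Rightarrow> 'k::field mpoly set \<Rightarrow> bool" where
  "generic e I \<longleftrightarrow>
     (\<exists>B. minimal_ideal_generators e I B \<and> (\<forall>f\<in>B. full_support_binomial e f))"

lemma cring_subring_on: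
  assumes "1 \<in> A" "\<And>a. a \<in> A \<Longrightarrow> - a \<in> A"
    "\<And>a b. a \<in> A \<Longrightarrow> b \<in> A \<Longrightarrow> a + b \<in> A" "\<And>a b. a \<in> A \<Longrightarrow> b \<in> A \<Longrightarrow> a * b \<in> A"
  shows "cring (subring_on A)"
proof (rule cringI)
  have "0 \<in> A" using assms(3)[OF assms(1) assms(2)[OF assms(1)]] by simp
  show "abelian_group (subring_on A)"
  proof (rule abelian_groupI)
    fix x assume "x \<in> carrier (subring_on A)"
    thus "\<exists>y\<in>carrier (subring_on A). y \<oplus>\<^bsub>subring_on A\<^esub> x = \<zero>\<^bsub>subring_on A\<^esub>"
      using assms(2) by (intro bexI[of _ "- x"]) (simp_all add: subring_on_def)
  qed (simp_all add: subring_on_def add_ac assms(3) \<open>0 \<in> A\<close>)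
  show "Group.comm_monoid (subring_on A)"
    by (rule comm_monoidI) (simp_all add: subring_on_def mult_ac assms)
qed (simp_all add: subring_on_def distrib_right)

lemma cring_poly_ring: "cring (poly_ring e :: 'k::field mpoly ring)"
proof (rule cring_subring_on)
  fix p q :: "'k mpoly" assume pq: "p \<in> polys_in e" "q \<in> polys_in e"
  show "p + q \<in> polys_in e"
    using pq Poly_Mapping.keys_add[of p q] unfolding polys_in_def by blast
  show "p * q \<in> polys_in e"
    unfolding polys_in_def
  proof (intro CollectI ballI)
    fix m assume "m \<in> Poly_Mapping.keys (p * q)"
    then obtain a b where "m = a + b" "a \<in> Poly_Mapping.keys p" "b \<in> Poly_Mapping.keys q"
      using keys_mult[of p q] by blast
    thus "Poly_Mapping.keys m \<subseteq> {1..e}"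
      using pq Poly_Mapping.keys_add[of a b] unfolding polys_in_def by blast
  qed
qed (auto simp: polys_in_def)

end

theory Submission
  imports Defs
begin

text \<open>
  Up to multiplicity three, an Arf semigroup \<open>S\<close> of multiplicity \<open>m\<close> has exactly \<open>m\<close> minimal
  generators \<open>m = n\<^sub>1 < \<dots> < n\<^sub>m\<close>, one in each residue class modulo \<open>m\<close>. For such a semigroup a
  sum \<open>n\<^sub>i + n\<^sub>j\<close> with \<open>i, j \<ge> 2\<close> lies in the residue class of exactly one \<open>n\<^sub>l\<close>, which yields
  a binomial \<open>x\<^sub>i x\<^sub>j - x\<^sub>1\<^sup>k x\<^sub>l\<close> of \<open>I\<^sub>S\<close> (with \<open>x\<^sub>l\<close> replaced by \<open>1\<close> if \<open>l = 1\<close>). These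
  binomials generate \<open>I\<^sub>S\<close>: they rewrite every monomial into one of the form \<open>x\<^sub>1\<^sup>k\<close> or
  \<open>x\<^sub>1\<^sup>k x\<^sub>l\<close> (\<open>normal_form_exists\<close>), and monomials of this form are told apart by their images
  \<open>t\<^sup>w\<close>, because the residue of \<open>w\<close> determines \<open>l\<close> (\<open>normal_exponent_eq_if_weight_eq\<close>).
  Hence any two monomials with the same image agree modulo these binomials, which is enough since
  \<open>I\<^sub>S\<close> is spanned by differences of such monomials (\<open>defining_ideal_subset_if_binomials\<close>).
  A minimal system of generators can be extracted from the finite set of these binomials, so it
  only remains to see that each of them has full support (\<open>generic_if_distinct_residues\<close>).

  For \<open>m = 1\<close> there are no binomials, and for \<open>m = 2\<close> the only one is \<open>x\<^sub>2\<^sup>2 - x\<^sub>1\<^bsup>n\<^esup>\<close>, where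
  \<open>n = n\<^sub>2\<close>. For \<open>m = 3\<close> let \<open>n\<^sub>2 = 3p + r\<close> with \<open>r \<in> {1, 2}\<close> and \<open>p \<ge> 1\<close>. The Arf property of
  \<open>3p \<le> n\<^sub>2 \<le> n\<^sub>2\<close> gives \<open>n\<^sub>2 + r \<in> S\<close>, so \<open>n\<^sub>3 = n\<^sub>2 + r\<close> and the three binomials are
  \<open>x\<^sub>2\<^sup>2 - x\<^sub>1\<^bsup>p\<^esup> x\<^sub>3\<close>, \<open>x\<^sub>3\<^sup>2 - x\<^sub>1\<^bsup>p+r\<^esup> x\<^sub>2\<close> and \<open>x\<^sub>2 x\<^sub>3 - x\<^sub>1\<^bsup>2p+r\<^esup>\<close>. All of them involve
  every variable since \<open>p \<ge> 1\<close>.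
\<close>

section \<open>The weight grading\<close>

definition weight :: "nat set \<Rightarrow> (nat \<Rightarrow>\<^sub>0 nat) \<Rightarrow> nat" where
  "weight S m = (\<Sum>i\<in>{1..embdim S}. gen S i * Poly_Mapping.lookup m i)"

abbreviation pure_binomial :: "(nat \<Rightarrow>\<^sub>0 nat) \<Rightarrow> (nat \<Rightarrow>\<^sub>0 nat) \<Rightarrow> 'k::field mpoly" where
  "pure_binomial a b \<equiv> Poly_Mapping.single a 1 - Poly_Mapping.single b 1"

lemma weight_add: "weight S (a + b) = weight S a + weight S b"
  by (simp add: weight_def lookup_add distrib_left sum.distrib)

lemma weight_zero [simp]: "weight S 0 = 0"
  by (simp add: weight_def)

lemma weight_single:
  assumes "i \<in> {1..embdim S}"
  shows "weight S (Poly_Mapping.single i k) = gen S i * k"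
proof -
  have "weight S (Poly_Mapping.single i k) =
      (\<Sum>j\<in>{1..embdim S}. if j = i then gen S i * k else 0)"
    unfolding weight_def by (intro sum.cong) (auto simp: lookup_single when_def)
  thus ?thesis using assms by simp
qed

lemma param_map_eq_sum_weight:
  fixes p :: "'k::field mpoly"
  shows "param_map S p =
    (\<Sum>m\<in>Poly_Mapping.keys p. Polynomial.monom (Poly_Mapping.lookup p m) (weight S m))"
proof -
  have "(\<Prod>i\<in>A. Polynomial.monom 1 (gen S i) ^ Poly_Mapping.lookup m i) =
      (Polynomial.monom 1 (\<Sum>i\<in>A. gen S i * Poly_Mapping.lookup m i) :: 'k poly)"
    if "finite A" for m A
    using that by (induction A) (simp_all add: monom_power mult_monom one_pCons monom_0)
  thus ?thesis
    by (simp add: param_map_def weight_def smult_monom)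
qed

lemma poly_mapping_eq_sum_singles:
  "p = (\<Sum>m\<in>Poly_Mapping.keys p. Poly_Mapping.single m (Poly_Mapping.lookup p m))"
  by (rule poly_mapping_eqI)
    (auto simp: lookup_sum lookup_single when_def in_keys_iff)

lemma param_map_add: "param_map S (p + q) = param_map S p + param_map S q"
  unfolding param_map_eq_sum_weight
  by (rule setsum_keys_plus_distrib) (simp_all add: add_monom)

lemma param_map_zero [simp]: "param_map S 0 = 0"
  by (simp add: param_map_def)

lemma param_map_single:
  "param_map S (Poly_Mapping.single m c) = Polynomial.monom c (weight S m)"
  by (cases "c = 0") (simp_all add: param_map_eq_sum_weight)

lemma param_map_sum: "param_map S (\<Sum>i\<in>A. f i) = (\<Sum>i\<in>A. param_map S (f i))"
  by (induction A rule: infinite_finite_induct) (simp_all add: param_map_add)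

lemma param_map_diff: "param_map S (p - q) = param_map S p - param_map S q"
  using param_map_add[of S "p - q" q] by (simp add: algebra_simps)

text \<open>By bilinearity, multiplicativity is a matter of monomials, where it is additivity of the
  weight.\<close>

lemma param_map_mult: "param_map S (p * q) = param_map S p * param_map S q"
proof -
  have "param_map S (p * q) = param_map S
      ((\<Sum>a\<in>Poly_Mapping.keys p. Poly_Mapping.single a (Poly_Mapping.lookup p a)) *
       (\<Sum>b\<in>Poly_Mapping.keys q. Poly_Mapping.single b (Poly_Mapping.lookup q b)))"
    by (simp only: poly_mapping_eq_sum_singles[symmetric])
  also have "\<dots> = param_map S p * param_map S q"
    unfolding param_map_eq_sum_weight[of S p] param_map_eq_sum_weight[of S q]
    by (simp add: sum_product mult_single param_map_sum param_map_single weight_add mult_monom)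
  finally show ?thesis .
qed


section \<open>Binomial generators of the defining ideal\<close>

lemma defining_ideal_iff:
  "p \<in> defining_ideal S \<longleftrightarrow> p \<in> polys_in (embdim S) \<and> param_map S p = 0"
  by (auto simp: defining_ideal_def a_kernel_def' semigroup_ring_def subring_on_def)

text \<open>The kernel is unchanged if the codomain \<open>\<bbbk>[S]\<close> is enlarged to \<open>\<bbbk>[t]\<close>, where the ring
  structure is immediate.\<close>

lemma ideal_defining_ideal:
  "ideal (defining_ideal S :: 'k::field mpoly set) (poly_ring (embdim S))"
proof -
  have "ring_hom_ring (poly_ring (embdim S)) (subring_on UNIV :: 'k poly ring) (param_map S)"
  proof (rule ring_hom_ringI)
    show "ring (poly_ring (embdim S) :: 'k mpoly ring)"
      by (rule cring.axioms(1)[OF cring_poly_ring])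
    show "ring (subring_on UNIV :: 'k poly ring)"
      by (rule cring.axioms(1)[OF cring_subring_on]) simp_all
  qed (simp_all add: subring_on_def param_map_add param_map_mult
      param_map_single[of S 0 1, simplified] monom_0 one_pCons)
  hence "ideal (a_kernel (poly_ring (embdim S)) (subring_on UNIV :: 'k poly ring) (param_map S))
      (poly_ring (embdim S))"
    by (rule ring_hom_ring.kernel_is_ideal)
  thus ?thesis
    by (simp add: defining_ideal_def a_kernel_def' semigroup_ring_def subring_on_def)
qed

lemma single_in_polys_in: "Poly_Mapping.keys a \<subseteq> {1..e} \<Longrightarrow> Poly_Mapping.single a c \<in> polys_in e"
  by (cases "c = 0") (simp_all add: polys_in_def)

lemma binomial_in_polys_in:
  assumes "Poly_Mapping.keys a \<subseteq> {1..e}" "Poly_Mapping.keys b \<subseteq> {1..e}"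
  shows "pure_binomial a b \<in> polys_in e"
  using keys_diff[of "Poly_Mapping.single a 1" "Poly_Mapping.single b 1"] assms
  by (auto simp: polys_in_def split: if_splits)

lemma binomial_in_defining_ideal_iff:
  assumes "Poly_Mapping.keys a \<subseteq> {1..embdim S}" "Poly_Mapping.keys b \<subseteq> {1..embdim S}"
  shows "(pure_binomial a b :: 'k::field mpoly) \<in> defining_ideal S \<longleftrightarrow> weight S a = weight S b"
  using binomial_in_polys_in[OF assms, where 'a = 'k]
  by (auto simp: defining_ideal_iff param_map_diff param_map_single monom_eq_iff')

text \<open>Congruence of monomials modulo an ideal \<open>J\<close> is an equivalence relation that is compatible with
  multiplication by monomials; these are the rules by which monomials are rewritten below.\<close>

context
  fixes e :: nat and J :: "'k::field mpoly set"
  assumes J: "ideal J (poly_ring e)"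
begin

lemma ideal_zero: "0 \<in> J"
  using additive_subgroup.zero_closed[OF ideal.axioms(1)[OF J]] by (simp add: subring_on_def)

lemma ideal_add: "p \<in> J \<Longrightarrow> q \<in> J \<Longrightarrow> p + q \<in> J"
  using additive_subgroup.a_closed[OF ideal.axioms(1)[OF J]] by (simp add: subring_on_def)

lemma ideal_mult: "r \<in> polys_in e \<Longrightarrow> p \<in> J \<Longrightarrow> r * p \<in> J"
  using ideal.I_l_closed[OF J] by (simp add: subring_on_def)

lemma ideal_sum: "(\<And>i. i \<in> A \<Longrightarrow> f i \<in> J) \<Longrightarrow> (\<Sum>i\<in>A. f i) \<in> J"
  by (induction A rule: infinite_finite_induct) (simp_all add: ideal_zero ideal_add)

lemma binomial_trans: "pure_binomial a b \<in> J \<Longrightarrow> pure_binomial b c \<in> J \<Longrightarrow> pure_binomial a c \<in> J"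
  using ideal_add[of "pure_binomial a b" "pure_binomial b c"] by simp

lemma binomial_sym:
  assumes "pure_binomial a b \<in> J"
  shows "pure_binomial b a \<in> J"
proof -
  have "Poly_Mapping.single 0 (-1) * pure_binomial a b \<in> J"
    by (rule ideal_mult[OF single_in_polys_in assms]) simp
  thus ?thesis by (simp add: algebra_simps mult_single single_uminus)
qed

lemma binomial_shift:
  assumes "Poly_Mapping.keys c \<subseteq> {1..e}" "pure_binomial a b \<in> J"
  shows "pure_binomial (c + a) (c + b) \<in> J"
  using ideal_mult[OF single_in_polys_in[OF assms(1)] assms(2), of 1]
  by (simp add: algebra_simps mult_single)

end

text \<open>Choose one monomial of \<open>p\<close> for each weight that occurs. Replacing every monomial of \<open>p\<close> by
  the chosen one of its weight changes \<open>p\<close> by an element of \<open>J\<close>. After the replacement the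
  coefficient of the monomial chosen for \<open>w\<close> is the coefficient of \<open>t\<^sup>w\<close> in the image of \<open>p\<close>,
  and this is zero.\<close>

lemma defining_ideal_subset_if_binomials:
  fixes J :: "'k::field mpoly set"
  assumes J: "ideal J (poly_ring (embdim S))"
    and binomials: "\<And>a b. Poly_Mapping.keys a \<subseteq> {1..embdim S} \<Longrightarrow>
      Poly_Mapping.keys b \<subseteq> {1..embdim S} \<Longrightarrow> weight S a = weight S b \<Longrightarrow> pure_binomial a b \<in> J"
  shows "defining_ideal S \<subseteq> J"
proof
  fix p :: "'k mpoly" assume "p \<in> defining_ideal S"
  hence p: "p \<in> polys_in (embdim S)" "param_map S p = 0" by (simp_all add: defining_ideal_iff)
  define K where "K = Poly_Mapping.keys p"
  have K: "finite K" "\<And>m. m \<in> K \<Longrightarrow> Poly_Mapping.keys m \<subseteq> {1..embdim S}"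
    using p(1) by (auto simp: K_def polys_in_def)
  define rep where "rep w = (SOME m. m \<in> K \<and> weight S m = w)" for w
  have rep: "rep (weight S m) \<in> K \<and> weight S (rep (weight S m)) = weight S m" if "m \<in> K" for m
    unfolding rep_def by (rule someI[of _ m]) (use that in simp)
  have coeff: "(\<Sum>m\<in>{m \<in> K. weight S m = w}. Poly_Mapping.lookup p m) = 0" for w
  proof -
    have "0 = Polynomial.coeff (param_map S p) w" using p(2) by simp
    also have "\<dots> = (\<Sum>m\<in>K. if weight S m = w then Poly_Mapping.lookup p m else 0)"
      by (simp add: param_map_eq_sum_weight coeff_sum K_def)
    finally show ?thesis using K(1) by (simp add: sum.If_cases Int_def)
  qed
  have "(\<Sum>m\<in>K. Poly_Mapping.single (rep (weight S m)) (Poly_Mapping.lookup p m)) =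
      (\<Sum>w\<in>weight S ` K. \<Sum>m\<in>{m \<in> K. weight S m = w}.
         Poly_Mapping.single (rep (weight S m)) (Poly_Mapping.lookup p m))"
    by (rule sum.image_gen[OF K(1)])
  also have "\<dots> = (\<Sum>w\<in>weight S ` K. Poly_Mapping.single (rep w)
      (\<Sum>m\<in>{m \<in> K. weight S m = w}. Poly_Mapping.lookup p m))"
  proof (intro sum.cong refl)
    fix w
    have "(\<Sum>m\<in>A. Poly_Mapping.single (rep w) (Poly_Mapping.lookup p m)) =
        Poly_Mapping.single (rep w) (\<Sum>m\<in>A. Poly_Mapping.lookup p m)" for A
      by (induction A rule: infinite_finite_induct) (simp_all add: single_add)
    thus "(\<Sum>m\<in>{m \<in> K. weight S m = w}.
          Poly_Mapping.single (rep (weight S m)) (Poly_Mapping.lookup p m)) =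
        Poly_Mapping.single (rep w) (\<Sum>m\<in>{m \<in> K. weight S m = w}. Poly_Mapping.lookup p m)"
      by simp
  qed
  also have "\<dots> = 0" by (simp add: coeff)
  finally have "p = (\<Sum>m\<in>K. Poly_Mapping.single m (Poly_Mapping.lookup p m)) -
      (\<Sum>m\<in>K. Poly_Mapping.single (rep (weight S m)) (Poly_Mapping.lookup p m))"
    using poly_mapping_eq_sum_singles[of p] by (simp add: K_def)
  also have "\<dots> = (\<Sum>m\<in>K. Poly_Mapping.single 0 (Poly_Mapping.lookup p m) *
      pure_binomial m (rep (weight S m)))"
    by (simp add: sum_subtractf right_diff_distrib mult_single)
  also have "\<dots> \<in> J"
    by (intro ideal_sum[OF J] ideal_mult[OF J] single_in_polys_in binomials)
      (use K(2) rep in auto)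
  finally show "p \<in> J" .
qed


section \<open>Generators with distinct residues\<close>

text \<open>The exponent of \<open>x\<^sub>1\<^sup>k x\<^sub>l\<close>, where the index \<open>l = 1\<close> stands for the factor \<open>1\<close> and not
  for \<open>x\<^sub>1\<close>. In this way each residue class modulo the first generator corresponds to one index
  in \<open>{1..e}\<close>, the class of \<open>0\<close> included.\<close>

definition normal_exponent :: "nat \<Rightarrow> nat \<Rightarrow> nat \<Rightarrow>\<^sub>0 nat" where
  "normal_exponent k l =
     Poly_Mapping.single 1 k + (if l = 1 then 0 else Poly_Mapping.single l 1)"

lemma keys_add_nat: "Poly_Mapping.keys (a + b) = Poly_Mapping.keys a \<union> Poly_Mapping.keys b"
  for a b :: "nat \<Rightarrow>\<^sub>0 nat"
  by (auto simp: in_keys_iff lookup_add)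

lemma keys_normal_exponent:
  "Poly_Mapping.keys (normal_exponent k l) = (if k = 0 then {} else {1}) \<union> (if l = 1 then {} else {l})"
  by (simp add: normal_exponent_def keys_add_nat)

lemma keys_normal_exponent_subset:
  "l \<in> {1..e} \<Longrightarrow> Poly_Mapping.keys (normal_exponent k l) \<subseteq> {1..e}"
  by (auto simp: keys_normal_exponent)

lemma weight_normal_exponent:
  assumes "l \<in> {1..embdim S}"
  shows "weight S (normal_exponent k l) = k * gen S 1 + (if l = 1 then 0 else gen S l)"
  using assms by (simp add: normal_exponent_def weight_add weight_single)

text \<open>The weight modulo the first generator determines \<open>l\<close>, and then the weight itself
  determines \<open>k\<close>.\<close>

lemma normal_exponent_eq_if_weight_eq:
  assumes "gen S 1 > 0" "inj_on (\<lambda>l. gen S l mod gen S 1) {1..embdim S}"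
    and "l \<in> {1..embdim S}" "l' \<in> {1..embdim S}"
    and eq: "weight S (normal_exponent k l) = weight S (normal_exponent k' l')"
  shows "normal_exponent k l = normal_exponent k' l'"
proof -
  have "weight S (normal_exponent k l) mod gen S 1 = gen S l mod gen S 1"
    if "l \<in> {1..embdim S}" for k l
    using that by (simp add: weight_normal_exponent)
  hence "gen S l mod gen S 1 = gen S l' mod gen S 1" using assms by metis
  hence "l = l'" using assms(2-4) by (auto dest: inj_onD)
  thus ?thesis using eq assms by (auto simp: weight_normal_exponent)
qed

text \<open>Induction on the total degree. Multiplying a normal monomial \<open>x\<^sub>1\<^sup>k x\<^sub>l\<close> by a variable
  \<open>x\<^sub>i\<close> gives a normal monomial again unless \<open>i, l \<ge> 2\<close>, and in that case the relation for
  \<open>x\<^sub>i x\<^sub>l\<close> applies.\<close>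

lemma normal_form_exists:
  fixes J :: "'k::field mpoly set"
  assumes J: "ideal J (poly_ring e)" and "e \<ge> 1"
    and products: "\<And>i j. i \<in> {2..e} \<Longrightarrow> j \<in> {2..e} \<Longrightarrow> \<exists>k. \<exists>l\<in>{1..e}.
      pure_binomial (Poly_Mapping.single i 1 + Poly_Mapping.single j 1) (normal_exponent k l) \<in> J"
    and "Poly_Mapping.keys a \<subseteq> {1..e}"
  shows "\<exists>k. \<exists>l\<in>{1..e}. pure_binomial a (normal_exponent k l) \<in> J"
  using assms(4)
proof (induction "\<Sum>i\<in>{1..e}. Poly_Mapping.lookup a i" arbitrary: a)
  case 0
  hence "\<forall>i\<in>{1..e}. Poly_Mapping.lookup a i = 0" by simp
  hence "Poly_Mapping.keys a = {}" using "0.prems" by (meson equals0I in_keys_iff subsetD)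
  hence "a = normal_exponent 0 1" by (simp add: normal_exponent_def)
  thus ?case using \<open>e \<ge> 1\<close> by (intro exI[of _ 0] bexI[of _ 1]) (simp_all add: ideal_zero[OF J])
next
  case (Suc d)
  then obtain i where i: "i \<in> {1..e}" "Poly_Mapping.lookup a i \<noteq> 0"
    by (metis Zero_not_Suc sum.neutral)
  define b where "b = a - Poly_Mapping.single i 1"
  have a: "a = Poly_Mapping.single i 1 + b"
    using i(2) by (intro poly_mapping_eqI) (auto simp: b_def lookup_add lookup_minus lookup_single when_def)
  have "(\<Sum>j\<in>{1..e}. Poly_Mapping.lookup a j) = 1 + (\<Sum>j\<in>{1..e}. Poly_Mapping.lookup b j)"
    using i(1) unfolding a by (simp add: lookup_add sum.distrib lookup_single when_def)
  moreover have "Poly_Mapping.keys b \<subseteq> {1..e}"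
    using Suc.prems unfolding a by (simp add: keys_add_nat)
  ultimately obtain k l where l: "l \<in> {1..e}" and b: "pure_binomial b (normal_exponent k l) \<in> J"
    using Suc.hyps(1)[of b] Suc.hyps(2) by auto
  have ab: "pure_binomial a (Poly_Mapping.single i 1 + normal_exponent k l) \<in> J"
    unfolding a by (rule binomial_shift[OF J _ b]) (use i(1) in simp)
  consider "i = 1" | "i \<ge> 2" "l = 1" | "i \<ge> 2" "l \<ge> 2" using i(1) l by fastforce
  thus ?case
  proof cases
    case 1
    hence "Poly_Mapping.single i 1 + normal_exponent k l = normal_exponent (Suc k) l"
      by (simp add: normal_exponent_def add.assoc[symmetric] single_add[symmetric])
    thus ?thesis using ab l by metis
  next
    case 2
    hence "Poly_Mapping.single i 1 + normal_exponent k l = normal_exponent k i"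
      by (simp add: normal_exponent_def add.commute)
    thus ?thesis using ab i(1) by metis
  next
    case 3
    then obtain k' l' where l': "l' \<in> {1..e}" and
      b': "pure_binomial (Poly_Mapping.single i 1 + Poly_Mapping.single l 1) (normal_exponent k' l') \<in> J"
      using products[of i l] i(1) l by auto
    have "pure_binomial (Poly_Mapping.single 1 k + (Poly_Mapping.single i 1 + Poly_Mapping.single l 1))
        (Poly_Mapping.single 1 k + normal_exponent k' l') \<in> J"
      by (rule binomial_shift[OF J _ b']) (use \<open>e \<ge> 1\<close> in simp)
    moreover have "Poly_Mapping.single 1 k + (Poly_Mapping.single i 1 + Poly_Mapping.single l 1) =
        Poly_Mapping.single i 1 + normal_exponent k l"
      using 3 by (simp add: normal_exponent_def ac_simps)
    moreover have "Poly_Mapping.single 1 k + normal_exponent k' l' = normal_exponent (k + k') l'"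
      by (simp add: normal_exponent_def single_add ac_simps)
    ultimately have "pure_binomial a (normal_exponent (k + k') l') \<in> J"
      using binomial_trans[OF J ab] by simp
    thus ?thesis using l' by blast
  qed
qed

text \<open>A generating subset of least cardinality is a minimal system of generators.\<close>

lemma generic_if_finite_generators:
  fixes I :: "'k::field mpoly set"
  assumes "finite B" "B \<subseteq> polys_in e" "Idl\<^bsub>poly_ring e\<^esub> B = I"
    and full: "\<And>f. f \<in> B \<Longrightarrow> full_support_binomial e f"
  shows "generic e I"
proof -
  define generating where "generating C \<longleftrightarrow> C \<subseteq> B \<and> Idl\<^bsub>poly_ring e\<^esub> C = I" for C
  have "generating B" using assms(3) by (simp add: generating_def)
  then obtain C where C: "generating C" "\<And>D. generating D \<Longrightarrow> card C \<le> card D"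
    using ex_has_least_nat[of generating B card] by blast
  have "C \<subseteq> B" "finite C" using C(1) assms(1) by (auto simp: generating_def finite_subset)
  have "Idl\<^bsub>poly_ring e\<^esub> D \<noteq> I" if "D \<subset> C" for D
  proof
    assume "Idl\<^bsub>poly_ring e\<^esub> D = I"
    hence "generating D" using that \<open>C \<subseteq> B\<close> by (auto simp: generating_def)
    thus False using C(2) psubset_card_mono[OF \<open>finite C\<close> that] by (meson not_less)
  qed
  hence "minimal_ideal_generators e I C"
    using C(1) assms(2) by (auto simp: minimal_ideal_generators_def generating_def)
  thus ?thesis using full \<open>C \<subseteq> B\<close> unfolding generic_def by blast
qed

text \<open>The conditions \<open>k > 0\<close> and \<open>{2..e} \<subseteq> {i, j, l}\<close> say that \<open>x\<^sub>i x\<^sub>j - x\<^sub>1\<^sup>k x\<^sub>l\<close>, read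
  with \<open>x\<^sub>l = 1\<close> for \<open>l = 1\<close>, has full support.\<close>

lemma generic_if_distinct_residues:
  assumes e: "embdim S \<ge> 1" and pos: "gen S 1 > 0"
    and inj: "inj_on (\<lambda>l. gen S l mod gen S 1) {1..embdim S}"
    and relations: "\<And>i j. i \<in> {2..embdim S} \<Longrightarrow> j \<in> {2..embdim S} \<Longrightarrow> \<exists>k>0. \<exists>l\<in>{1..embdim S}.
      gen S i + gen S j = k * gen S 1 + (if l = 1 then 0 else gen S l) \<and>
      {2..embdim S} \<subseteq> {i, j, l}"
  shows "generic (embdim S) (defining_ideal S :: 'k::field mpoly set)"
proof -
  define e where "e = embdim S"
  define P where "P = {2..e} \<times> {2..e}"
  define lhs :: "nat \<times> nat \<Rightarrow> nat \<Rightarrow>\<^sub>0 nat"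
    where "lhs = (\<lambda>(i, j). Poly_Mapping.single i 1 + Poly_Mapping.single j 1)"
  have "\<exists>b. (\<exists>k. \<exists>l\<in>{1..e}. b = normal_exponent k l) \<and> weight S (lhs x) = weight S b \<and>
      Poly_Mapping.keys (lhs x) \<union> Poly_Mapping.keys b = {1..e}" if x: "x \<in> P" for x
  proof -
    obtain i j where ij: "x = (i, j)" "i \<in> {2..e}" "j \<in> {2..e}" using x by (auto simp: P_def)
    then obtain k l where kl: "k > 0" "l \<in> {1..e}"
      "gen S i + gen S j = k * gen S 1 + (if l = 1 then 0 else gen S l)" "{2..e} \<subseteq> {i, j, l}"
      using relations[of i j] unfolding e_def by metis
    have "weight S (lhs x) = weight S (normal_exponent k l)"
      using ij kl by (simp add: e_def lhs_def weight_add weight_single weight_normal_exponent)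
    moreover have "Poly_Mapping.keys (lhs x) \<union> Poly_Mapping.keys (normal_exponent k l) =
        {i, j} \<union> {1, l}"
      using kl(1) by (auto simp: ij(1) lhs_def keys_add_nat keys_normal_exponent)
    moreover have "{i, j} \<union> {1, l} = {1..e}"
    proof
      show "{i, j} \<union> {1, l} \<subseteq> {1..e}" using ij kl by auto
      have "{1..e} \<subseteq> insert 1 {2..e}" by auto
      thus "{1..e} \<subseteq> {i, j} \<union> {1, l}" using kl(4) by blast
    qed
    ultimately show ?thesis using kl(2) by metis
  qed
  then obtain rhs where rhs: "\<And>x. x \<in> P \<Longrightarrow> \<exists>k. \<exists>l\<in>{1..e}. rhs x = normal_exponent k l"
    "\<And>x. x \<in> P \<Longrightarrow> weight S (lhs x) = weight S (rhs x)"
    "\<And>x. x \<in> P \<Longrightarrow> Poly_Mapping.keys (lhs x) \<union> Poly_Mapping.keys (rhs x) = {1..e}"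
    by metis
  define B :: "'k mpoly set" where "B = (\<lambda>x. pure_binomial (lhs x) (rhs x)) ` P"
  interpret R: cring "poly_ring e :: 'k mpoly ring" by (rule cring_poly_ring)
  have B_I: "B \<subseteq> defining_ideal S"
  proof
    fix f assume "f \<in> B"
    then obtain x where x: "x \<in> P" "f = pure_binomial (lhs x) (rhs x)" by (auto simp: B_def)
    thus "f \<in> defining_ideal S"
      using rhs(2,3)[OF x(1)]
      by (metis binomial_in_defining_ideal_iff e_def sup_ge1 sup_ge2)
  qed
  hence B_polys: "B \<subseteq> polys_in e" by (auto simp: defining_ideal_iff e_def)
  define J where "J = Idl\<^bsub>poly_ring e\<^esub> B"
  have J: "ideal J (poly_ring e)"
    unfolding J_def by (rule R.genideal_ideal) (use B_polys in \<open>simp add: subring_on_def\<close>)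
  have B_J: "B \<subseteq> J"
    unfolding J_def by (rule R.genideal_self) (use B_polys in \<open>simp add: subring_on_def\<close>)
  have J_I: "J \<subseteq> defining_ideal S"
    unfolding J_def by (rule R.genideal_minimal) (use B_I ideal_defining_ideal e_def in auto)
  \<comment> \<open>Reduction preserves weights because \<open>J\<close> lies in the defining ideal; so monomials of equal weight
     have normal forms of equal weight, and these coincide.\<close>
  have normal: "\<exists>k. \<exists>l\<in>{1..e}. (pure_binomial a (normal_exponent k l) :: 'k mpoly) \<in> J"
    if "Poly_Mapping.keys a \<subseteq> {1..e}" for a
  proof (rule normal_form_exists[OF J _ _ that])
    show "e \<ge> 1" using e by (simp add: e_def)
    fix i j assume "i \<in> {2..e}" "j \<in> {2..e}"
    hence ij: "(i, j) \<in> P" by (simp add: P_def)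
    hence "pure_binomial (lhs (i, j)) (rhs (i, j)) \<in> J" using B_J by (auto simp: B_def)
    thus "\<exists>k. \<exists>l\<in>{1..e}.
        (pure_binomial (Poly_Mapping.single i 1 + Poly_Mapping.single j 1) (normal_exponent k l) :: 'k mpoly) \<in> J"
      using rhs(1)[OF ij] by (metis lhs_def case_prod_conv)
  qed
  have "defining_ideal S \<subseteq> J"
  proof (rule defining_ideal_subset_if_binomials)
    show "ideal J (poly_ring (embdim S))" using J by (simp add: e_def)
    fix a b assume ab: "Poly_Mapping.keys a \<subseteq> {1..embdim S}" "Poly_Mapping.keys b \<subseteq> {1..embdim S}"
      "weight S a = weight S b"
    obtain k l where a: "l \<in> {1..embdim S}" "(pure_binomial a (normal_exponent k l) :: 'k mpoly) \<in> J"
      using normal[of a] ab(1) by (auto simp: e_def)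
    obtain k' l' where b: "l' \<in> {1..embdim S}" "(pure_binomial b (normal_exponent k' l') :: 'k mpoly) \<in> J"
      using normal[of b] ab(2) by (auto simp: e_def)
    have "weight S a = weight S (normal_exponent k l)" "weight S b = weight S (normal_exponent k' l')"
      using J_I a b ab keys_normal_exponent_subset
      by (metis binomial_in_defining_ideal_iff[where 'k = 'k] subsetD)+
    hence "normal_exponent k l = normal_exponent k' l'"
      using normal_exponent_eq_if_weight_eq[OF pos inj] a(1) b(1) ab(3) by simp
    thus "(pure_binomial a b :: 'k mpoly) \<in> J"
      using binomial_trans[OF J a(2)] binomial_sym[OF J b(2)] by simp
  qed
  with J_I have "Idl\<^bsub>poly_ring e\<^esub> B = defining_ideal S" by (auto simp: J_def)
  moreover have "full_support_binomial e f" if "f \<in> B" for f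
    using that rhs(3) unfolding B_def full_support_binomial_def by blast
  moreover have "finite B" by (simp add: B_def P_def)
  ultimately show ?thesis
    using generic_if_finite_generators[OF _ B_polys] by (simp add: e_def)
qed


section \<open>Arf semigroups of multiplicity at most three\<close>

lemma multiples_in_submonoid:
  assumes "add_submonoid S" "m \<in> S"
  shows "k * m \<in> S"
  using assms by (induction k) (auto simp: add_submonoid_def)

lemma multiplicity_of_properties:
  assumes "numerical_semigroup S"
  shows "multiplicity_of S \<in> S" "multiplicity_of S \<noteq> 0"
    "\<And>s. s \<in> S \<Longrightarrow> s \<noteq> 0 \<Longrightarrow> multiplicity_of S \<le> s"
proof -
  obtain n where "n \<notin> insert 0 (- S)"
    using assms by (metis finite.insertI infinite_UNIV_nat numerical_semigroup_def finite_subset subsetI)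
  hence ex: "n \<in> S \<and> n \<noteq> 0" by simp
  show "multiplicity_of S \<in> S" "multiplicity_of S \<noteq> 0"
    using LeastI[of "\<lambda>n. n \<in> S \<and> n \<noteq> 0", OF ex] by (auto simp: multiplicity_of_def)
  show "multiplicity_of S \<le> s" if "s \<in> S" "s \<noteq> 0" for s
    using that unfolding multiplicity_of_def by (simp add: Least_le)
qed

text \<open>Non-multiples of \<open>m\<close> exist in \<open>S\<close> because \<open>S\<close> contains all large numbers.\<close>

lemma least_nonmultiple:
  assumes S: "numerical_semigroup S" and m: "m \<ge> 2"
  obtains n where "n \<in> S" "\<not> m dvd n" "\<And>s. s \<in> S \<Longrightarrow> \<not> m dvd s \<Longrightarrow> n \<le> s"
proof -
  obtain N where "\<forall>x\<in>- S. x < N"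
    using S finite_nat_set_iff_bounded by (auto simp: numerical_semigroup_def)
  hence "N * m + 1 \<in> S" using m by (metis ComplI add_lessD1 less_irrefl mult_le_mono2
    nat_mult_1_right one_le_numeral order.strict_trans1 order.trans)
  moreover have "\<not> m dvd N * m + 1"
  proof
    assume "m dvd N * m + 1"
    hence "m dvd 1" by (metis dvd_add_right_iff dvd_triv_right)
    thus False using m by simp
  qed
  ultimately have "N * m + 1 \<in> S \<and> \<not> m dvd N * m + 1" ..
  from LeastI[of "\<lambda>n. n \<in> S \<and> \<not> m dvd n", OF this] show thesis
    using that[of "LEAST n. n \<in> S \<and> \<not> m dvd n"] by (simp add: Least_le)
qed

lemma generic_multiplicity_one:
  assumes S: "numerical_semigroup S" and m: "multiplicity_of S = 1"
  shows "generic (embdim S) (defining_ideal S :: 'k::field mpoly set)"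
proof -
  have sub: "add_submonoid S" using S by (simp add: numerical_semigroup_def)
  have 1: "1 \<in> S" using multiplicity_of_properties(1)[OF S] m by simp
  have UNIV: "S = UNIV" using multiples_in_submonoid[OF sub 1] by auto
  have gens: "minimal_generators S = {1}"
    unfolding minimal_generators_eq[OF sub]
  proof (intro equalityI subsetI)
    fix n assume n: "n \<in> {n \<in> S. n \<noteq> 0 \<and> \<not> (\<exists>a\<in>S - {0}. \<exists>b\<in>S - {0}. n = a + b)}"
    have "n = 1 + (n - 1)" using n by simp
    thus "n \<in> {1}" using n unfolding UNIV by (metis (mono_tags, lifting) CollectD DiffI UNIV_I
      add_0_right empty_iff insert_iff one_neq_zero)
  qed (auto simp: UNIV)
  have "embdim S = 1" "gen S 1 = 1" by (simp_all add: embdim_def gen_def gens)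
  thus ?thesis by (intro generic_if_distinct_residues) auto
qed

text \<open>Besides \<open>2\<close>, the only minimal generator is the least odd element \<open>n\<close>, as the other odd
  elements are \<open>n\<close> plus an even number. The single relation is \<open>2 n = n \<cdot> 2\<close>.\<close>

lemma generic_multiplicity_two:
  assumes S: "numerical_semigroup S" and m: "multiplicity_of S = 2"
  shows "generic (embdim S) (defining_ideal S :: 'k::field mpoly set)"
proof -
  have sub: "add_submonoid S" using S by (simp add: numerical_semigroup_def)
  have 2: "2 \<in> S" and min: "\<And>s. s \<in> S \<Longrightarrow> s \<noteq> 0 \<Longrightarrow> 2 \<le> s"
    using multiplicity_of_properties[OF S] m by auto
  obtain n where n: "n \<in> S" "odd n" "\<And>s. s \<in> S \<Longrightarrow> odd s \<Longrightarrow> n \<le> s"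
    using least_nonmultiple[OF S, of 2] by auto
  have n2: "n > 2" using min[OF n(1)] n(2) by (cases "n = 0"; cases "n = 2") auto
  have gens: "minimal_generators S = {2, n}"
    unfolding minimal_generators_eq[OF sub]
  proof (intro equalityI subsetI)
    fix s assume s: "s \<in> {n \<in> S. n \<noteq> 0 \<and> \<not> (\<exists>a\<in>S - {0}. \<exists>b\<in>S - {0}. n = a + b)}"
    show "s \<in> {2, n}"
    proof (rule ccontr)
      assume neq: "s \<notin> {2, n}"
      \<comment> \<open>\<open>a\<close> is the claimed generator congruent to \<open>s\<close>, so \<open>s - a\<close> is a multiple of \<open>2\<close>.\<close>
      define a where "a = (if even s then 2 else n)"
      have "a \<in> S - {0}" using 2 n(1) n2 by (auto simp: a_def)
      have "a \<le> s" "a \<noteq> s" using s neq min[of s] n(3)[of s] by (auto simp: a_def)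
      have "even (s - a)" using \<open>a \<le> s\<close> n(2) by (auto simp: a_def)
      then obtain k where "s - a = k * 2" by (metis dvd_def mult.commute)
      hence "s - a \<in> S - {0}" "s = a + (s - a)"
        using multiples_in_submonoid[OF sub 2, of k] \<open>a \<le> s\<close> \<open>a \<noteq> s\<close> by auto
      thus False using s \<open>a \<in> S - {0}\<close> by blast
    qed
  next
    fix s assume "s \<in> {2, n}"
    moreover have "2 \<noteq> a + b" if "a \<in> S - {0}" "b \<in> S - {0}" for a b
      using that min[of a] min[of b] by auto
    moreover have "n \<noteq> a + b" if "a \<in> S - {0}" "b \<in> S - {0}" for a b
    proof
      assume "n = a + b"
      hence "odd a \<or> odd b" using n(2) by auto
      moreover have "a < n" "b < n" using that \<open>n = a + b\<close> by auto
      ultimately show False using n(3) that by (meson DiffD1 not_less)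
    qed
    ultimately show "s \<in> {n \<in> S. n \<noteq> 0 \<and> \<not> (\<exists>a\<in>S - {0}. \<exists>b\<in>S - {0}. n = a + b)}"
      using 2 n(1) n2 by auto
  qed
  have e: "embdim S = 2" and g: "gen S 1 = 2" "gen S (Suc 0) = 2" "gen S 2 = n"
    using n2 by (simp_all add: embdim_def gen_def gens)
  have interval: "{1..2} = {1, 2::nat}" by auto
  show ?thesis
  proof (rule generic_if_distinct_residues)
    show "inj_on (\<lambda>l. gen S l mod gen S 1) {1..embdim S}"
      unfolding e interval using n(2) by (simp add: g odd_iff_mod_2_eq_one)
    fix i j assume "i \<in> {2..embdim S}" "j \<in> {2..embdim S}"
    hence "i = 2" "j = 2" by (auto simp: e)
    thus "\<exists>k>0. \<exists>l\<in>{1..embdim S}.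
        gen S i + gen S j = k * gen S 1 + (if l = 1 then 0 else gen S l) \<and>
        {2..embdim S} \<subseteq> {i, j, l}"
      using n2 by (intro exI[of _ n] conjI bexI[of _ 1]) (simp_all add: e g)
  qed (simp_all add: e g)
qed

text \<open>Let \<open>n = 3p + r\<close> be the least element of \<open>S\<close> not divisible by \<open>3\<close>. Then \<open>n + r\<close> is the
  least number \<open>\<ge> n\<close> in the remaining residue class, and the Arf property puts it into \<open>S\<close>. So the
  minimal generators are \<open>3\<close>, \<open>n\<close> and \<open>n + r\<close>, and the relations are
  \<open>2n = 3p + (n + r)\<close>, \<open>2(n + r) = 3(p + r) + n\<close> and \<open>n + (n + r) = 3(2p + r)\<close>.\<close>

lemma generic_multiplicity_three:
  assumes S: "numerical_semigroup S" and "arf S" and m: "multiplicity_of S = 3"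
  shows "generic (embdim S) (defining_ideal S :: 'k::field mpoly set)"
proof -
  have sub: "add_submonoid S" using S by (simp add: numerical_semigroup_def)
  have 3: "3 \<in> S" and min: "\<And>s. s \<in> S \<Longrightarrow> s \<noteq> 0 \<Longrightarrow> 3 \<le> s"
    using multiplicity_of_properties[OF S] m by auto
  obtain n where n: "n \<in> S" "\<not> 3 dvd n" "\<And>s. s \<in> S \<Longrightarrow> \<not> 3 dvd s \<Longrightarrow> n \<le> s"
    using least_nonmultiple[OF S, of 3] by auto
  define p r where "p = n div 3" and "r = n mod 3"
  have nr: "n = 3 * p + r" by (simp add: p_def r_def)
  have r: "r = 1 \<or> r = 2" using n(2) unfolding r_def by presburger
  have "n \<noteq> 0" using n(2) by (cases "n = 0") auto
  hence "p > 0" using min[OF n(1)] by (simp add: p_def div_greater_zero_iff)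
  have "p * 3 \<in> S" by (rule multiples_in_submonoid[OF sub 3])
  moreover have "p * 3 \<le> n" using nr by simp
  \<comment> \<open>Subtracting the largest multiple of \<open>3\<close> below \<open>n\<close> gives the smallest element that the Arf property
     can produce from \<open>n\<close> twice and a multiple of \<open>3\<close>.\<close>
  ultimately have "n + n - p * 3 \<in> S" using \<open>arf S\<close> n(1) unfolding arf_def by blast
  moreover have "n + n - p * 3 = n + r" using nr by simp
  ultimately have nr_S: "n + r \<in> S" by simp
  have gens: "minimal_generators S = {3, n, n + r}"
    unfolding minimal_generators_eq[OF sub]
  proof (intro equalityI subsetI)
    fix s assume s: "s \<in> {n \<in> S. n \<noteq> 0 \<and> \<not> (\<exists>a\<in>S - {0}. \<exists>b\<in>S - {0}. n = a + b)}"
    show "s \<in> {3, n, n + r}"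
    proof (rule ccontr)
      assume neq: "s \<notin> {3, n, n + r}"
      \<comment> \<open>\<open>a\<close> is the claimed generator congruent to \<open>s\<close>, so \<open>s - a\<close> is a multiple of \<open>3\<close>.\<close>
      define a where "a = (if 3 dvd s then 3 else if s mod 3 = n mod 3 then n else n + r)"
      have "a \<in> S - {0}" using 3 n nr_S \<open>n \<noteq> 0\<close> by (auto simp: a_def)
      have mod: "a mod 3 = s mod 3"
        using nr r by (auto simp: a_def) presburger+
      have "a \<le> s"
      proof (cases "3 dvd s")
        case True thus ?thesis using s min[of s] by (simp add: a_def)
      next
        case False
        hence "n \<le> s" using s n(3)[of s] by simp
        moreover have "a \<le> n + 2" using r False by (auto simp: a_def)
        ultimately have "a - s < 3" by linarith
        moreover have "3 dvd a - s" using mod by (cases "s \<le> a") (simp_all add: mod_eq_dvd_iff_nat)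
        ultimately show ?thesis by (auto dest: dvd_imp_le)
      qed
      have "a \<noteq> s" using neq by (auto simp: a_def)
      have "3 dvd s - a" using mod \<open>a \<le> s\<close> by (metis mod_eq_dvd_iff_nat)
      then obtain k where "s - a = k * 3" by (metis dvd_def mult.commute)
      hence "s - a \<in> S - {0}" "s = a + (s - a)"
        using multiples_in_submonoid[OF sub 3, of k] \<open>a \<le> s\<close> \<open>a \<noteq> s\<close> by auto
      thus False using s \<open>a \<in> S - {0}\<close> by blast
    qed
  next
    fix s assume "s \<in> {3, n, n + r}"
    moreover have "s \<noteq> a + b" if ab: "a \<in> S - {0}" "b \<in> S - {0}" for a b
    proof
      assume s: "s = a + b"
      \<comment> \<open>Of two nonzero summands of \<open>n\<close> or \<open>n + r\<close> one is no multiple of \<open>3\<close>. That one is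
         at least \<open>n\<close> and the other at least \<open>3\<close>, so \<open>s \<ge> n + 3\<close>; but \<open>s \<le> n + 2\<close>.\<close>
      have ge: "a \<ge> 3" "b \<ge> 3" using ab min by auto
      have ndvd: "3 dvd a \<or> n \<le> a" "3 dvd b \<or> n \<le> b" using ab n(3) by auto
      consider "s = 3" | "s = 3 * p + r" | "s = 3 * p + 2 * r"
        using \<open>s \<in> {3, n, n + r}\<close> nr by auto
      thus False
        using ge ndvd s r \<open>p > 0\<close> unfolding nr by cases (presburger+)
    qed
    ultimately show "s \<in> {n \<in> S. n \<noteq> 0 \<and> \<not> (\<exists>a\<in>S - {0}. \<exists>b\<in>S - {0}. n = a + b)}"
      using 3 n(1) nr_S \<open>n \<noteq> 0\<close> by auto
  qed
  have n3: "n > 3" "r > 0" using nr r \<open>p > 0\<close> by auto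
  have e: "embdim S = 3" and g: "gen S 1 = 3" "gen S (Suc 0) = 3" "gen S 2 = n" "gen S 3 = n + r"
    using n3 by (simp_all add: embdim_def gen_def gens)
  have interval: "{1..3} = {1, 2, 3::nat}" "{2..3} = {2, 3::nat}" by auto
  show ?thesis
  proof (rule generic_if_distinct_residues)
    show "inj_on (\<lambda>l. gen S l mod gen S 1) {1..embdim S}"
      unfolding e interval using nr r by (auto simp: g)
    fix i j assume ij: "i \<in> {2..embdim S}" "j \<in> {2..embdim S}"
    consider "i = 2" "j = 2" | "i = 3" "j = 3" | "i = 2" "j = 3" | "i = 3" "j = 2"
      using ij by (auto simp: e interval)
    thus "\<exists>k>0. \<exists>l\<in>{1..embdim S}.
        gen S i + gen S j = k * gen S 1 + (if l = 1 then 0 else gen S l) \<and>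
        {2..embdim S} \<subseteq> {i, j, l}"
    proof cases
      case 1
      show ?thesis
        by (rule exI[of _ p], intro conjI bexI[of _ 3])
          (use 1 \<open>p > 0\<close> nr in \<open>auto simp: e g interval\<close>)
    next
      case 2
      show ?thesis
        by (rule exI[of _ "p + r"], intro conjI bexI[of _ 2])
          (use 2 \<open>p > 0\<close> nr in \<open>auto simp: e g interval\<close>)
    qed (use \<open>p > 0\<close> nr in \<open>intro exI[of _ "2 * p + r"] conjI bexI[of _ 1];
        simp add: e g interval\<close>)+
  qed (simp_all add: e g)
qed

theorem theorem5p7:
  fixes S :: "nat set"
  assumes "numerical_semigroup S"
    and "arf S"
    and "multiplicity_of S < 4"
  shows "generic (embdim S) (defining_ideal S :: 'k::{alg_closed_field, field_char_0} mpoly set)"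
proof -
  have "multiplicity_of S = 1 \<or> multiplicity_of S = 2 \<or> multiplicity_of S = 3"
    using multiplicity_of_properties(2)[OF assms(1)] assms(3) by linarith
  thus ?thesis
    using generic_multiplicity_one generic_multiplicity_two generic_multiplicity_three assms(1,2)
    by metis
qed

end
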